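(* Let $n$ be a positive integer. Let $f\in C[0,1]$ and $p\in\mathcal{P}_n$ with $p=P_{\mathcal{P}_n}(f)$. For any $\mu,\gamma\in C^*[0,1]$: (i) if $\mu([0,1])\ne\gamma([0,1])$, then $\gamma\notin\widehat{D}^*P_{\mathcal{P}_n}(f,p)(\mu)$ and $\mu\notin\widehat{D}^*P_{\mathcal{P}_n}(f,p)(\gamma)$; (ii) if $\mu([0,1])\ne0$, then $\theta^*\notin\widehat{D}^*P_{\mathcal{P}_n}(f,p)(\mu)$ and $\mu\notin\widehat{D}^*P_{\mathcal{P}_n}(f,p)(\theta^* )$; (iii) if $\langle\gamma,f-p\rangle<0$, then $\gamma\notin\widehat{D}^*P_{\mathcal{P}_n}(f,p)(\mu)$ for any $\mu\in C^*[0,1]$.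
   Context: $C[0,1]$ is the Banach space of continuous real-valued functions on $[0,1]$ with norm $\|f\|=\max_{0\le t\le1}|f(t)|$. Its dual $C^*[0,1]$ is identified, by the Riesz representation theorem, with the space $rca[0,1]$ of real-valued regular countably additive set functions (signed measures) on the Borel $\sigma$-field of $[0,1]$, with pairing $\langle\mu,f\rangle=\int_0^1f(t)\,\mu(dt)$. $\theta^*$ is the origin of $C^*[0,1]$. $\mathcal{P}_n$ is the closed subspace of $C[0,1]$ of all real polynomials of degree less than or equal to $n$. The metric projection $P_{\mathcal{P}_n}:C[0,1]\to\mathcal{P}_n$ assigns to $f$ its (unique) best uniform approximation: $p=P_{\mathcal{P}_n}(f)$ iff $p\in\mathcal{P}_n$ and $\|f-p\|=\min\{\|f-q\|:q\in\mathcal{P}_n\}$. For $f\in C[0,1]$ and $p=P_{\mathcal{P}_n}(f)$, the Mordukhovich derivative of $P_{\mathcal{P}_n}$ at $(f,p)$ is the set-valued mapping $\widehat{D}^*P_{\mathcal{P}_n}(f,p):C^*[0,1]\rightrightarrows C^*[0,1]$ given by $$\widehat{D}^*P_{\mathcal{P}_n}(f,p)(\mu)=\left\{\gamma\in C^*[0,1]:\limsup_{\substack{(g,q)\to(f,p)\\ q=P_{\mathcal{P}_n}(g)}}\frac{\langle\gamma,g-f\rangle-\langle\mu,q-p\rangle}{\|g-f\|+\|q-p\|}\le0\right\},$$ where the limsup is over pairs $(g,q)\neq(f,p)$. *)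

theory Defs
  imports "HOL-Analysis.Analysis"
begin

section \<open>The Banach space of continuous functions on the unit interval\<close>

typedef unit_interval = "{0..1::real}"
  morphisms coord Unit_Interval
  by (rule exI[of _ 0]) simp

instantiation unit_interval :: metric_space
begin

definition dist_unit_interval :: "unit_interval \<Rightarrow> unit_interval \<Rightarrow> real"
  where "dist_unit_interval s t = dist (coord s) (coord t)"

definition uniformity_unit_interval :: "(unit_interval \<times> unit_interval) filter"
  where "uniformity_unit_interval = (INF e\<in>{0 <..}. principal {(x, y). dist x y < e})"

definition open_unit_interval :: "unit_interval set \<Rightarrow> bool"
  where "open_unit_interval S = (\<forall>x\<in>S. \<forall>\<^sub>F (x', y) in uniformity. x' = x \<longrightarrow> y \<in> S)"

instance
proof
  fix x y z :: unit_interval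
  show "dist x y = 0 \<longleftrightarrow> x = y"
    by (simp add: dist_unit_interval_def coord_inject)
  show "dist x y \<le> dist x z + dist y z"
    unfolding dist_unit_interval_def by (rule dist_triangle2)
qed (rule open_unit_interval_def uniformity_unit_interval_def)+

end

lemma compact_unit_interval: "compact (UNIV :: unit_interval set)"
proof -
  have "continuous_on {0..1} Unit_Interval"
    unfolding continuous_on_iff
  proof (intro ballI allI impI)
    fix x e :: real
    assume x: "x \<in> {0..1}" and "0 < e"
    have "dist (Unit_Interval y) (Unit_Interval x) = dist y x" if "y \<in> {0..1}" for y
      using x that by (simp add: dist_unit_interval_def Unit_Interval_inverse)
    then show "\<exists>d>0. \<forall>y\<in>{0..1}. dist y x < d \<longrightarrow> dist (Unit_Interval y) (Unit_Interval x) < e"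
      using \<open>0 < e\<close> by auto
  qed
  then have "compact (Unit_Interval ` {0..1})"
    by (rule compact_continuous_image) simp
  moreover have "Unit_Interval ` {0..1} = UNIV"
    by (metis coord coord_inverse surjI image_eqI UNIV_eq_I)
  ultimately show ?thesis by simp
qed

text \<open>As the domain is compact, the boundedness built into the type \<open>bcontfun\<close> is no
  restriction, and the supremum defining its norm is a maximum.\<close>

type_synonym C01 = "unit_interval \<Rightarrow>\<^sub>C real"

lemma bcontfun_unit_interval:
  "(bcontfun :: (unit_interval \<Rightarrow> real) set) = {f. continuous_on UNIV f}"
  unfolding bcontfun_def
  using compact_continuous_image[OF _ compact_unit_interval] compact_imp_bounded by blast

lemma norm_C01_attained:
  fixes f :: C01
  shows "(\<forall>t. \<bar>apply_bcontfun f t\<bar> \<le> norm f) \<and> (\<exists>t. \<bar>apply_bcontfun f t\<bar> = norm f)"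
proof -
  have le: "\<bar>apply_bcontfun f t\<bar> \<le> norm f" for t
    using norm_bounded[of f t] by simp
  have "continuous_on UNIV (\<lambda>t. \<bar>apply_bcontfun f t\<bar>)"
    by (intro continuous_intros) auto
  then obtain s where s: "\<And>t. \<bar>apply_bcontfun f t\<bar> \<le> \<bar>apply_bcontfun f s\<bar>"
    using continuous_attains_sup[OF compact_unit_interval] by blast
  then have "norm f \<le> \<bar>apply_bcontfun f s\<bar>"
    by (intro norm_bound) simp
  with le show ?thesis by (meson order_antisym)
qed

section \<open>The dual space as a space of signed measures\<close>

text \<open>A set function is only meaningful on Borel sets; it is normalised to \<open>0\<close>
  elsewhere, so that distinct members of \<open>rca01\<close> are distinct signed measures.\<close>

definition rca01 :: "(unit_interval set \<Rightarrow> real) set" where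
  "rca01 = {\<mu>.
     (\<forall>A. A \<notin> sets borel \<longrightarrow> \<mu> A = 0) \<and>
     \<mu> {} = 0 \<and>
     (\<forall>A :: nat \<Rightarrow> unit_interval set.
        range A \<subseteq> sets borel \<and> disjoint_family A \<longrightarrow> (\<lambda>i. \<mu> (A i)) sums \<mu> (\<Union>i. A i)) \<and>
     (\<forall>E\<in>sets borel. \<forall>\<epsilon>>0. \<exists>F G. closed F \<and> open G \<and> F \<subseteq> E \<and> E \<subseteq> G \<and>
        (\<forall>B\<in>sets borel. B \<subseteq> G - F \<longrightarrow> \<bar>\<mu> B\<bar> < \<epsilon>))}"

text \<open>The positive part of the Jordan decomposition,
  \<open>\<mu>\<^sup>+(E) = sup {\<mu>(B) | B \<subseteq> E Borel}\<close>; the negative part is the positive part of \<open>-\<mu>\<close>.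
  Since \<open>B = {}\<close> is admitted, the truncation of negative values by \<open>ennreal\<close> does not affect
  the supremum.\<close>

definition positive_part :: "(unit_interval set \<Rightarrow> real) \<Rightarrow> unit_interval measure" where
  "positive_part \<mu> = measure_of UNIV (sets borel)
     (\<lambda>E. SUP B\<in>{B \<in> sets borel. B \<subseteq> E}. ennreal (\<mu> B))"

definition pairing :: "(unit_interval set \<Rightarrow> real) \<Rightarrow> C01 \<Rightarrow> real" where
  "pairing \<mu> f =
     (\<integral>t. apply_bcontfun f t \<partial>positive_part \<mu>) -
     (\<integral>t. apply_bcontfun f t \<partial>positive_part (\<lambda>A. - \<mu> A))"

abbreviation zero_functional :: "unit_interval set \<Rightarrow> real" where
  "zero_functional \<equiv> (\<lambda>_. 0)"

section \<open>The metric projection onto polynomials and its Mordukhovich derivative\<close>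

definition polys_upto :: "nat \<Rightarrow> C01 set" where
  "polys_upto n =
     {q. \<exists>P :: real poly. degree P \<le> n \<and> (\<forall>t. apply_bcontfun q t = poly P (coord t))}"

text \<open>\<open>is_metric_projection S f p\<close> expresses \<open>p = P\<^sub>S(f)\<close>, i.e. the metric projection is
  given by its graph. For \<open>S = polys_upto n\<close> the graph is that of a function
  on the whole space by the existence and uniqueness of best uniform approximations.\<close>

definition is_metric_projection :: "C01 set \<Rightarrow> C01 \<Rightarrow> C01 \<Rightarrow> bool" where
  "is_metric_projection S f p \<longleftrightarrow> p \<in> S \<and> (\<forall>q\<in>S. norm (f - p) \<le> norm (f - q))"

text \<open>The filter \<open>at (f, p) within _\<close> excludes the point \<open>(f, p)\<close> itself, so the
  denominator is nonzero along it. The quotient is embedded into the extended reals because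
  \<open>Limsup\<close> needs a complete lattice.\<close>

definition mordukhovich_derivative ::
    "C01 set \<Rightarrow> C01 \<Rightarrow> C01 \<Rightarrow> (unit_interval set \<Rightarrow> real) \<Rightarrow> (unit_interval set \<Rightarrow> real) set" where
  "mordukhovich_derivative S f p \<mu> =
     {\<gamma> \<in> rca01.
        Limsup (at (f, p) within {(g, q). is_metric_projection S g q})
          (\<lambda>(g, q). ereal ((pairing \<gamma> (g - f) - pairing \<mu> (q - p)) / (norm (g - f) + norm (q - p))))
        \<le> 0}"

end

theory Submission
  imports Defs
begin

text \<open>Membership of \<open>\<gamma>\<close> in the derivative at \<open>(f, p)\<close> is refuted along straight lines. If
  \<open>(f + s u, p + s v)\<close> lies on the graph of the projection for all small \<open>s > 0\<close>, then the
  difference quotient is constant along this ray, equal to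
  \<open>(\<langle>\<gamma>, u\<rangle> - \<langle>\<mu>, v\<rangle>) / (\<parallel>u\<parallel> + \<parallel>v\<parallel>)\<close>, so that \<open>\<gamma>\<close> is excluded as soon as
  \<open>\<langle>\<mu>, v\<rangle> < \<langle>\<gamma>, u\<rangle>\<close> (lemma \<open>not_in_mordukhovich_derivative_if_ray\<close>).

  The projection onto a subspace supplies two kinds of rays. It commutes with translations by
  elements of the subspace; translating by a constant of suitable sign gives
  \<open>\<langle>\<gamma>, u\<rangle> - \<langle>\<mu>, v\<rangle> = \<bar>\<gamma>([0,1]) - \<mu>([0,1])\<bar>\<close>, whence (i), and (ii) is the special case in which one
  of the two measures vanishes. Moreover \<open>p\<close> stays the best approximation when \<open>f\<close> is moved
  towards \<open>p\<close>, which gives the ray \<open>u = p - f\<close>, \<open>v = 0\<close> and hence (iii).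

  What remains is to see that integrating a constant \<open>c\<close> against \<open>\<mu>\<close> gives
  \<open>c \<mu>([0,1])\<close>. The integral being defined through the Jordan decomposition, this
  needs that the positive part is a measure, that it is finite, and that
  \<open>\<mu>\<^sup>+([0,1]) - \<mu>\<^sup>-([0,1]) = \<mu>([0,1])\<close>.\<close>

section \<open>Signed measures and their positive parts\<close>

lemma rca01_empty: "\<mu> \<in> rca01 \<Longrightarrow> \<mu> {} = 0"
  by (simp add: rca01_def)

lemma rca01_sums:
  assumes "\<mu> \<in> rca01" "range A \<subseteq> sets borel" "disjoint_family A"
  shows "(\<lambda>i. \<mu> (A i)) sums \<mu> (\<Union>i. A i)"
  using assms by (simp add: rca01_def)

lemma rca01_Un:
  assumes \<mu>: "\<mu> \<in> rca01" and "A \<in> sets borel" "B \<in> sets borel" "A \<inter> B = {}"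
  shows "\<mu> (A \<union> B) = \<mu> A + \<mu> B"
proof -
  have "disjoint_family (binaryset A B)"
    using assms(4) by (simp add: disjoint_family_on_def binaryset_def Int_commute)
  then have "(\<lambda>i. \<mu> (binaryset A B i)) sums \<mu> (A \<union> B)"
    using rca01_sums[OF \<mu>, of "binaryset A B"] assms(2,3)
    by (simp add: range_binaryset_eq UN_binaryset_eq)
  then show ?thesis
    using binaryset_sums[of \<mu> A B, OF rca01_empty[OF \<mu>]] sums_unique2 by blast
qed

lemma rca01_regular:
  assumes "\<mu> \<in> rca01" "E \<in> sets borel" "0 < \<epsilon>"
  shows "\<exists>F G. closed F \<and> open G \<and> F \<subseteq> E \<and> E \<subseteq> G \<and>
    (\<forall>B\<in>sets borel. B \<subseteq> G - F \<longrightarrow> \<bar>\<mu> B\<bar> < \<epsilon>)"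
  using assms by (simp add: rca01_def)

lemma rca01_uminus:
  assumes "\<mu> \<in> rca01"
  shows "(\<lambda>A. - \<mu> A) \<in> rca01"
  using assms unfolding rca01_def by (auto intro: sums_minus)

lemma zero_in_rca01: "zero_functional \<in> rca01"
proof -
  have "\<exists>F G :: unit_interval set. closed F \<and> open G \<and> F \<subseteq> E \<and> E \<subseteq> G" for E
    by (rule exI[of _ "{}"], rule exI[of _ UNIV]) simp
  then show ?thesis
    unfolding rca01_def by simp
qed

text \<open>Boundedness is a consequence of regularity and compactness: applied to a single
  point \<open>t\<close>, regularity yields a neighbourhood of \<open>t\<close> on whose Borel subsets \<open>\<bar>\<mu>\<bar>\<close> is at
  most \<open>\<bar>\<mu> {t}\<bar> + 1\<close>, and finitely many such neighbourhoods cover the space.\<close>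

lemma rca01_bounded:
  assumes \<mu>: "\<mu> \<in> rca01"
  obtains K where "\<And>B. B \<in> sets borel \<Longrightarrow> \<bar>\<mu> B\<bar> \<le> K"
proof -
  define bdd where "bdd U \<longleftrightarrow> (\<exists>K. \<forall>B\<in>sets borel. B \<subseteq> U \<longrightarrow> \<bar>\<mu> B\<bar> \<le> K)" for U
  have "\<exists>G. open G \<and> t \<in> G \<and> bdd G" for t
  proof -
    obtain F G where FG: "F \<subseteq> {t}" "{t} \<subseteq> G" "open G"
        "\<And>B. B \<in> sets borel \<Longrightarrow> B \<subseteq> G - F \<Longrightarrow> \<bar>\<mu> B\<bar> < 1"
      using rca01_regular[OF \<mu>, of "{t}" 1] by auto
    have "\<bar>\<mu> B\<bar> \<le> \<bar>\<mu> {t}\<bar> + 1" if B: "B \<in> sets borel" "B \<subseteq> G" for B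
    proof -
      have small: "\<bar>\<mu> (B - {t})\<bar> < 1"
        using FG B by (intro FG(4)) auto
      show ?thesis
      proof (cases "t \<in> B")
        case True
        then have "(B - {t}) \<union> {t} = B" by auto
        then have "\<mu> B = \<mu> (B - {t}) + \<mu> {t}"
          using rca01_Un[OF \<mu>, of "B - {t}" "{t}"] B(1) by simp
        then show ?thesis using small by linarith
      next
        case False
        then show ?thesis using small by simp
      qed
    qed
    then show ?thesis
      using FG unfolding bdd_def by blast
  qed
  then obtain G where G: "\<And>t. open (G t)" "\<And>t. t \<in> G t" "\<And>t. bdd (G t)"
    by metis
  have cover: "UNIV \<subseteq> (\<Union>t. G t)"
    using G(2) by blast
  obtain T where T: "finite T" "UNIV \<subseteq> (\<Union>t\<in>T. G t)"
    by (rule compactE_image[OF compact_unit_interval G(1) cover])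
  have "bdd (\<Union>t\<in>T. G t)"
    using \<open>finite T\<close>
  proof induction
    case empty
    then show ?case
      unfolding bdd_def by (intro exI[of _ 0]) (simp add: rca01_empty[OF \<mu>])
  next
    case (insert t T)
    obtain K L where K: "\<And>B. B \<in> sets borel \<Longrightarrow> B \<subseteq> G t \<Longrightarrow> \<bar>\<mu> B\<bar> \<le> K"
      and L: "\<And>B. B \<in> sets borel \<Longrightarrow> B \<subseteq> (\<Union>t\<in>T. G t) \<Longrightarrow> \<bar>\<mu> B\<bar> \<le> L"
      using insert.IH G(3)[of t] unfolding bdd_def by blast
    have "\<bar>\<mu> B\<bar> \<le> K + L" if B: "B \<in> sets borel" "B \<subseteq> (\<Union>t\<in>insert t T. G t)" for B
    proof -
      have "G t \<in> sets borel" using G(1) by simp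
      moreover have "(B \<inter> G t) \<union> (B - G t) = B" "(B \<inter> G t) \<inter> (B - G t) = {}"
        by auto
      ultimately have "\<mu> B = \<mu> (B \<inter> G t) + \<mu> (B - G t)"
        using rca01_Un[OF \<mu>, of "B \<inter> G t" "B - G t"] B(1) by simp
      moreover have "\<bar>\<mu> (B \<inter> G t)\<bar> \<le> K" "\<bar>\<mu> (B - G t)\<bar> \<le> L"
        using B G(1) by (intro K L; auto)+
      ultimately show ?thesis by linarith
    qed
    then show ?case unfolding bdd_def by blast
  qed
  moreover have "(\<Union>t\<in>T. G t) = UNIV"
    using T(2) by blast
  ultimately show ?thesis
    using that by (auto simp: bdd_def)
qed

lemma ennreal_sums_le_suminf:
  fixes x :: "nat \<Rightarrow> real"
  assumes "x sums s"
  shows "ennreal s \<le> (\<Sum>i. ennreal (x i))"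
proof (rule LIMSEQ_le_const2)
  show "(\<lambda>n. ennreal (\<Sum>i<n. x i)) \<longlonglongrightarrow> ennreal s"
    using assms by (intro tendsto_ennrealI) (simp add: sums_def)
  have "ennreal (\<Sum>i<n. x i) \<le> (\<Sum>i<n. ennreal (x i))" for n
  proof (induction n)
    case (Suc n)
    have "ennreal (\<Sum>i<Suc n. x i) \<le> ennreal (\<Sum>i<n. x i) + ennreal (x n)"
      by (auto simp: ennreal_plus_if intro!: ennreal_leI)
    also have "\<dots> \<le> (\<Sum>i<Suc n. ennreal (x i))"
      using Suc by (simp add: add_right_mono)
    finally show ?case .
  qed simp
  then show "\<exists>N. \<forall>n\<ge>N. ennreal (\<Sum>i<n. x i) \<le> (\<Sum>i. ennreal (x i))"
    by (meson order_trans sum_le_suminf summableI finite_lessThan zero_le)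
qed

text \<open>The supremum over subsets is countably additive: it is superadditive because
  disjoint competitors can be united, and countably subadditive because a competitor for the
  union is cut into its pieces.\<close>

lemma emeasure_positive_part:
  assumes \<mu>: "\<mu> \<in> rca01" and E: "E \<in> sets borel"
  shows "emeasure (positive_part \<mu>) E = (SUP B\<in>{B \<in> sets borel. B \<subseteq> E}. ennreal (\<mu> B))"
proof -
  define P where "P E = (SUP B\<in>{B \<in> sets borel. B \<subseteq> E}. ennreal (\<mu> B))" for E
  have upper: "ennreal (\<mu> B) \<le> P E" if "B \<in> sets borel" "B \<subseteq> E" for B E
    unfolding P_def using that by (intro SUP_upper) auto
  have super: "P C + P D \<le> P (C \<union> D)" if "C \<inter> D = {}" for C D
  proof -
    have pair: "ennreal (\<mu> A) + ennreal (\<mu> B) \<le> P (C \<union> D)"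
      if AB: "A \<in> sets borel" "A \<subseteq> C" "B \<in> sets borel" "B \<subseteq> D" for A B
    proof -
      have "A \<inter> B = {}" using AB \<open>C \<inter> D = {}\<close> by blast
      then have "\<mu> (A \<union> B) = \<mu> A + \<mu> B"
        using AB by (intro rca01_Un[OF \<mu>])
      moreover have "ennreal (\<mu> (A \<union> B)) \<le> P (C \<union> D)"
        using AB by (intro upper sets.Un) blast+
      ultimately have "ennreal (\<mu> A + \<mu> B) \<le> P (C \<union> D)"
        by simp
      moreover have "ennreal (\<mu> A) \<le> P (C \<union> D)" "ennreal (\<mu> B) \<le> P (C \<union> D)"
        using AB by (intro upper; blast)+
      ultimately show ?thesis
        by (cases "0 \<le> \<mu> A"; cases "0 \<le> \<mu> B") (simp_all add: ennreal_neg)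
    qed
    have ne: "{B \<in> sets borel. B \<subseteq> E} \<noteq> {}" for E :: "unit_interval set"
      by auto
    have "P C + P D = (SUP A\<in>{A \<in> sets borel. A \<subseteq> C}. ennreal (\<mu> A) + P D)"
      unfolding P_def by (rule ennreal_SUP_add_left[OF ne, symmetric])
    also have "\<dots> \<le> P (C \<union> D)"
    proof (rule SUP_least)
      fix A assume A: "A \<in> {A \<in> sets borel. A \<subseteq> C}"
      have "ennreal (\<mu> A) + P D
          = (SUP B\<in>{B \<in> sets borel. B \<subseteq> D}. ennreal (\<mu> B) + ennreal (\<mu> A))"
        unfolding P_def by (subst ennreal_SUP_add_left[OF ne]) (simp add: add.commute)
      also have "\<dots> \<le> P (C \<union> D)"
        using A by (intro SUP_least, subst add.commute) (auto intro: pair)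
      finally show "ennreal (\<mu> A) + P D \<le> P (C \<union> D)" .
    qed
    finally show ?thesis .
  qed
  have mono: "P C \<le> P D" if "C \<subseteq> D" for C D
    unfolding P_def using that by (intro SUP_subset_mono) auto
  have "countably_additive (sets borel) P"
    unfolding countably_additive_def
  proof (intro allI impI antisym)
    fix A :: "nat \<Rightarrow> unit_interval set"
    assume A: "range A \<subseteq> sets borel" and disj: "disjoint_family A"
    have partial: "(\<Sum>i<n. P (A i)) \<le> P (\<Union>i<n. A i)" for n
    proof (induction n)
      case (Suc n)
      have "A i \<inter> A n = {}" if "i < n" for i
        using disj that by (simp add: disjoint_family_on_def)
      then have "(\<Union>i<n. A i) \<inter> A n = {}"
        by blast
      from super[OF this] have "P (\<Union>i<n. A i) + P (A n) \<le> P (\<Union>i<Suc n. A i)"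
        by (simp add: lessThan_Suc Un_commute)
      moreover have "(\<Sum>i<Suc n. P (A i)) \<le> P (\<Union>i<n. A i) + P (A n)"
        using Suc by (simp add: add_right_mono)
      ultimately show ?case
        by (rule order_trans[rotated])
    qed simp
    show "(\<Sum>i. P (A i)) \<le> P (\<Union>i. A i)"
      by (intro suminf_le_const summableI order_trans[OF partial] mono) auto
    show "P (\<Union>i. A i) \<le> (\<Sum>i. P (A i))"
      unfolding P_def[of "\<Union>i. A i"]
    proof (rule SUP_least)
      fix B assume B: "B \<in> {B \<in> sets borel. B \<subseteq> (\<Union>i. A i)}"
      have "(\<lambda>i. \<mu> (B \<inter> A i)) sums \<mu> (\<Union>i. B \<inter> A i)"
        using A B disj by (intro rca01_sums[OF \<mu>]) (auto simp: disjoint_family_on_def)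
      moreover have "(\<Union>i. B \<inter> A i) = B" using B by auto
      ultimately have "ennreal (\<mu> B) \<le> (\<Sum>i. ennreal (\<mu> (B \<inter> A i)))"
        by (metis ennreal_sums_le_suminf)
      also have "\<dots> \<le> (\<Sum>i. P (A i))"
        using A B by (intro suminf_le summableI upper) auto
      finally show "ennreal (\<mu> B) \<le> (\<Sum>i. P (A i))" .
    qed
  qed
  moreover have "positive (sets borel) P"
    using rca01_empty[OF \<mu>] by (simp add: positive_def P_def)
  moreover have "sigma_algebra UNIV (sets (borel :: unit_interval measure))"
    using sets.sigma_algebra_axioms[of "borel :: unit_interval measure"] by simp
  ultimately have "emeasure (measure_of UNIV (sets borel) P) E = P E"
    using E by (intro emeasure_measure_of_sigma)
  then show ?thesis
    unfolding positive_part_def P_def .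
qed

text \<open>Infinite mass would make \<open>measure\<close> the default value \<open>0\<close>; boundedness of \<open>\<mu>\<close> makes the mass of \<open>\<mu>\<^sup>+\<close> a genuine least upper bound of the values of
  \<open>\<mu>\<close>.\<close>

lemma
  assumes \<mu>: "\<mu> \<in> rca01"
  shows measure_positive_part_upper: "\<And>B. B \<in> sets borel \<Longrightarrow> \<mu> B \<le> measure (positive_part \<mu>) UNIV"
    and measure_positive_part_least:
      "\<And>u. 0 \<le> u \<Longrightarrow> (\<And>B. B \<in> sets borel \<Longrightarrow> \<mu> B \<le> u) \<Longrightarrow> measure (positive_part \<mu>) UNIV \<le> u"
proof -
  have eq: "emeasure (positive_part \<mu>) UNIV = (SUP B\<in>sets borel. ennreal (\<mu> B))"
    using emeasure_positive_part[OF \<mu>, of UNIV] by simp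
  have bound: "emeasure (positive_part \<mu>) UNIV \<le> ennreal u"
    if "\<And>B. B \<in> sets borel \<Longrightarrow> \<mu> B \<le> u" for u
    unfolding eq using that by (auto intro!: SUP_least ennreal_leI)
  obtain K where "\<And>B. B \<in> sets borel \<Longrightarrow> \<bar>\<mu> B\<bar> \<le> K"
    using rca01_bounded[OF \<mu>] by blast
  then have "emeasure (positive_part \<mu>) UNIV \<le> ennreal K"
    by (intro bound) (meson abs_le_iff)
  then have fin: "emeasure (positive_part \<mu>) UNIV = ennreal (measure (positive_part \<mu>) UNIV)"
    by (intro emeasure_eq_ennreal_measure) (auto simp: top_unique)
  show "\<mu> B \<le> measure (positive_part \<mu>) UNIV" if "B \<in> sets borel" for B
  proof -
    have "ennreal (\<mu> B) \<le> ennreal (measure (positive_part \<mu>) UNIV)"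
      unfolding fin[symmetric] eq using that by (rule SUP_upper)
    then show ?thesis by simp
  qed
  show "measure (positive_part \<mu>) UNIV \<le> u"
    if "0 \<le> u" "\<And>B. B \<in> sets borel \<Longrightarrow> \<mu> B \<le> u" for u
    using bound[OF that(2)] that(1) unfolding fin by simp
qed

text \<open>From \<open>- \<mu> B = \<mu> (- B) - \<mu> UNIV \<le> \<mu>\<^sup>+ UNIV - \<mu> UNIV\<close> one gets
  \<open>\<mu>\<^sup>- UNIV \<le> \<mu>\<^sup>+ UNIV - \<mu> UNIV\<close>; replacing \<open>\<mu>\<close> by \<open>- \<mu>\<close> gives the opposite inequality.\<close>

lemma measure_positive_part_diff:
  assumes \<mu>: "\<mu> \<in> rca01"
  shows "measure (positive_part \<mu>) UNIV - measure (positive_part (\<lambda>A. - \<mu> A)) UNIV = \<mu> UNIV"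
proof -
  have le: "measure (positive_part (\<lambda>A. - \<nu> A)) UNIV \<le> measure (positive_part \<nu>) UNIV - \<nu> UNIV"
    if \<nu>: "\<nu> \<in> rca01" for \<nu>
  proof (rule measure_positive_part_least[OF rca01_uminus[OF \<nu>]])
    show "0 \<le> measure (positive_part \<nu>) UNIV - \<nu> UNIV"
      using measure_positive_part_upper[OF \<nu>, of UNIV] by simp
    fix B :: "unit_interval set" assume B: "B \<in> sets borel"
    then have "- B \<in> sets borel" by (simp add: borel_comp)
    moreover from this B have "\<nu> UNIV = \<nu> B + \<nu> (- B)"
      using rca01_Un[OF \<nu>, of B "- B"] by simp
    ultimately show "- \<nu> B \<le> measure (positive_part \<nu>) UNIV - \<nu> UNIV"
      using measure_positive_part_upper[OF \<nu>, of "- B"] by simp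
  qed
  show ?thesis
    using le[OF \<mu>] le[OF rca01_uminus[OF \<mu>]] by simp
qed

lemma pairing_const:
  assumes "\<mu> \<in> rca01"
  shows "pairing \<mu> (const_bcontfun c) = c * \<mu> UNIV"
proof -
  have space: "space (positive_part \<nu>) = UNIV" for \<nu>
    unfolding positive_part_def by (rule space_measure_of) simp
  show ?thesis
    unfolding pairing_def const_bcontfun.rep_eq
    by (simp add: space measure_positive_part_diff[OF assms, symmetric] algebra_simps)
qed

lemma pairing_scaleR: "pairing \<mu> (c *\<^sub>R f) = c * pairing \<mu> f"
  by (simp add: pairing_def right_diff_distrib)

lemma pairing_zero: "pairing \<mu> 0 = 0"
  using pairing_scaleR[of \<mu> 0 0] by simp

lemma pairing_uminus: "pairing \<mu> (- f) = - pairing \<mu> f"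
  using pairing_scaleR[of \<mu> "-1" f] by simp

section \<open>Rays in the graph of a metric projection\<close>

lemma not_in_mordukhovich_derivative_if_ray:
  assumes graph: "\<forall>\<^sub>F s in at_right (0::real). is_metric_projection S (f + s *\<^sub>R u) (p + s *\<^sub>R v)"
    and less: "pairing \<mu> v < pairing \<gamma> u"
  shows "\<gamma> \<notin> mordukhovich_derivative S f p \<mu>"
proof
  define c where "c = (pairing \<gamma> u - pairing \<mu> v) / (norm u + norm v)"
  define Q where "Q = (\<lambda>(g, q). ereal ((pairing \<gamma> (g - f) - pairing \<mu> (q - p)) /
    (norm (g - f) + norm (q - p))))"
  define z where "z s = (f + s *\<^sub>R u, p + s *\<^sub>R v)" for s :: real
  let ?F = "at (f, p) within {(g, q). is_metric_projection S g q}"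
  have ne: "u \<noteq> 0 \<or> v \<noteq> 0"
    using less pairing_zero by force
  then have "norm u + norm v > 0"
    by (metis add_nonneg_pos add_pos_nonneg norm_ge_zero zero_less_norm_iff)
  with less have "c > 0"
    by (simp add: c_def)
  assume "\<gamma> \<in> mordukhovich_derivative S f p \<mu>"
  then have "Limsup ?F Q \<le> 0"
    by (simp add: mordukhovich_derivative_def Q_def)
  with \<open>c > 0\<close> have "Limsup ?F Q < ereal c"
    by (metis ereal_less(2) le_less_trans)
  then have "\<forall>\<^sub>F x in ?F. Q x < ereal c"
    by (rule Limsup_lessD)
  moreover have "filterlim z ?F (at_right 0)"
    unfolding filterlim_at
  proof
    have "((\<lambda>s. (f + s *\<^sub>R u, p + s *\<^sub>R v)) \<longlongrightarrow> (f + 0 *\<^sub>R u, p + 0 *\<^sub>R v)) (at_right 0)"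
      by (intro tendsto_intros)
    then show "(z \<longlongrightarrow> (f, p)) (at_right 0)"
      by (simp add: z_def[abs_def])
    show "\<forall>\<^sub>F s in at_right 0. z s \<in> {(g, q). is_metric_projection S g q} \<and> z s \<noteq> (f, p)"
      using graph eventually_at_right_less[of "0::real"]
      by eventually_elim (use ne in \<open>auto simp: z_def\<close>)
  qed
  ultimately have "\<forall>\<^sub>F s in at_right 0. Q (z s) < ereal c"
    by (rule eventually_compose_filterlim)
  then have "\<forall>\<^sub>F s in at_right (0::real). False"
    using eventually_at_right_less[of "0::real"]
  proof eventually_elim
    case (elim s)
    have "(s * pairing \<gamma> u - s * pairing \<mu> v) / (s * norm u + s * norm v)
        = (s * (pairing \<gamma> u - pairing \<mu> v)) / (s * (norm u + norm v))"
      by (simp add: algebra_simps)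
    also have "\<dots> = c"
      using elim(2) by (simp add: c_def)
    finally have "Q (z s) = ereal c"
      using elim(2) by (simp add: Q_def z_def pairing_scaleR)
    with elim(1) show ?case by simp
  qed
  then show False
    by simp
qed

lemma is_metric_projection_translate:
  assumes "subspace S" "is_metric_projection S f p" "v \<in> S"
  shows "is_metric_projection S (f + v) (p + v)"
  unfolding is_metric_projection_def
proof (intro conjI ballI)
  show "p + v \<in> S"
    using assms by (simp add: is_metric_projection_def subspace_add)
  fix q assume "q \<in> S"
  then have "norm (f - p) \<le> norm (f - (q - v))"
    using assms by (simp add: is_metric_projection_def subspace_diff)
  then show "norm (f + v - (p + v)) \<le> norm (f + v - q)"
    by (simp add: algebra_simps)
qed

lemma is_metric_projection_shrink:
  assumes S: "subspace S" and proj: "is_metric_projection S f p" and s: "s < 1"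
  shows "is_metric_projection S (f + s *\<^sub>R (p - f)) p"
  unfolding is_metric_projection_def
proof (intro conjI ballI)
  show p: "p \<in> S"
    using proj by (simp add: is_metric_projection_def)
  fix q assume "q \<in> S"
  \<comment> \<open>An approximant \<open>q\<close> of the shrunk function corresponds to the approximant \<open>r\<close> of \<open>f\<close>
    obtained by undoing the homothety with centre \<open>p\<close> and ratio \<open>1 - s\<close>.\<close>
  define r where "r = p + (1 / (1 - s)) *\<^sub>R (q - p)"
  have "r \<in> S"
    using S p \<open>q \<in> S\<close> by (simp add: r_def subspace_add subspace_diff subspace_scale)
  then have "(1 - s) * norm (f - p) \<le> (1 - s) * norm (f - r)"
    using proj s by (simp add: is_metric_projection_def)
  then have "norm ((1 - s) *\<^sub>R (f - p)) \<le> norm ((1 - s) *\<^sub>R (f - r))"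
    using s by simp
  moreover have "(1 - s) *\<^sub>R (f - p) = f + s *\<^sub>R (p - f) - p"
    by (simp add: algebra_simps)
  moreover have "(1 - s) *\<^sub>R (f - r) = f + s *\<^sub>R (p - f) - q"
  proof -
    have "(1 - s) *\<^sub>R (f - r) = (1 - s) *\<^sub>R (f - p) - (q - p)"
      using s by (simp add: r_def scaleR_diff_right scaleR_add_right)
    then show ?thesis by (simp add: algebra_simps)
  qed
  ultimately show "norm (f + s *\<^sub>R (p - f) - p) \<le> norm (f + s *\<^sub>R (p - f) - q)"
    by simp
qed

lemma subspace_polys_upto: "subspace (polys_upto n)"
  unfolding subspace_def polys_upto_def
proof (safe, goal_cases)
  case 1
  show ?case by (rule exI[of _ 0]) simp
next
  case (2 x y P Q)
  then show ?case by (intro exI[of _ "P + Q"]) (simp add: degree_add_le)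
next
  case (3 c x P)
  then show ?case
    by (intro exI[of _ "smult c P"]) (auto intro: order_trans[OF degree_smult_le])
qed

lemma const_in_polys_upto: "const_bcontfun c \<in> polys_upto n"
  unfolding polys_upto_def by (auto simp: const_bcontfun.rep_eq intro!: exI[of _ "[:c:]"])

section \<open>Measures excluded from the derivative\<close>

lemma not_in_mordukhovich_derivative_if_total_mass_ne:
  assumes S: "subspace S" "\<And>c. const_bcontfun c \<in> S" and proj: "is_metric_projection S f p"
    and \<mu>: "\<mu> \<in> rca01" and \<gamma>: "\<gamma> \<in> rca01" and ne: "\<mu> UNIV \<noteq> \<gamma> UNIV"
  shows "\<gamma> \<notin> mordukhovich_derivative S f p \<mu>"
proof (rule not_in_mordukhovich_derivative_if_ray)
  define u :: C01 where "u = const_bcontfun (sgn (\<gamma> UNIV - \<mu> UNIV))"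
  show "\<forall>\<^sub>F s in at_right 0. is_metric_projection S (f + s *\<^sub>R u) (p + s *\<^sub>R u)"
    using S proj by (auto simp: u_def intro!: always_eventually is_metric_projection_translate
        subspace_scale)
  have "sgn (\<gamma> UNIV - \<mu> UNIV) * (\<gamma> UNIV - \<mu> UNIV) > 0"
    using ne by (simp add: sgn_real_def)
  then show "pairing \<mu> u < pairing \<gamma> u"
    by (simp add: u_def pairing_const \<mu> \<gamma> algebra_simps)
qed

lemma not_in_mordukhovich_derivative_if_pairing_residual_neg:
  assumes "subspace S" "is_metric_projection S f p" "pairing \<gamma> (f - p) < 0"
  shows "\<gamma> \<notin> mordukhovich_derivative S f p \<nu>"
proof (rule not_in_mordukhovich_derivative_if_ray)
  show "\<forall>\<^sub>F s in at_right 0. is_metric_projection S (f + s *\<^sub>R (p - f)) (p + s *\<^sub>R 0)"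
    using assms is_metric_projection_shrink
    by (auto simp: eventually_at_right_field intro!: exI[of _ 1])
  show "pairing \<nu> 0 < pairing \<gamma> (p - f)"
    using assms(3) pairing_uminus[of \<gamma> "f - p"] by (simp add: pairing_zero)
qed

theorem theorem5p10:
  fixes n :: nat and f p :: C01 and \<mu> \<gamma> :: "unit_interval set \<Rightarrow> real"
  assumes "n \<ge> 1"
    and "p \<in> polys_upto n"
    and "is_metric_projection (polys_upto n) f p"
    and "\<mu> \<in> rca01" and "\<gamma> \<in> rca01"
  shows "(\<mu> UNIV \<noteq> \<gamma> UNIV \<longrightarrow>
            \<gamma> \<notin> mordukhovich_derivative (polys_upto n) f p \<mu> \<and>
            \<mu> \<notin> mordukhovich_derivative (polys_upto n) f p \<gamma>) \<and>
         (\<mu> UNIV \<noteq> 0 \<longrightarrow>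
            zero_functional \<notin> mordukhovich_derivative (polys_upto n) f p \<mu> \<and>
            \<mu> \<notin> mordukhovich_derivative (polys_upto n) f p zero_functional) \<and>
         (pairing \<gamma> (f - p) < 0 \<longrightarrow>
            (\<forall>\<nu>\<in>rca01. \<gamma> \<notin> mordukhovich_derivative (polys_upto n) f p \<nu>))"
proof -
  note mass = not_in_mordukhovich_derivative_if_total_mass_ne
    [OF subspace_polys_upto const_in_polys_upto assms(3)]
  note residual = not_in_mordukhovich_derivative_if_pairing_residual_neg
    [OF subspace_polys_upto assms(3)]
  show ?thesis
    using mass[OF assms(4,5)] mass[OF assms(5,4)] mass[OF assms(4) zero_in_rca01]
      mass[OF zero_in_rca01 assms(4)] residual
    by metis
qed

end
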